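(* For every 2-connected chordal graph $G$, $\mathrm{lct}(G)\leq\max\{1,\omega(G)-3\}$.
   Context: A graph is chordal if every induced cycle has length three. $\omega(G)$ is the cardinality of a maximum clique of $G$. $\mathrm{lct}(G)$ is the minimum cardinality of a set of vertices that intersects every longest cycle (cycle of maximum length) of $G$. *)

theory Defs
  imports Main
begin

definition simple_graph :: "'a set \<Rightarrow> ('a \<Rightarrow> 'a \<Rightarrow> bool) \<Rightarrow> bool" where
  "simple_graph V E \<longleftrightarrow> finite V \<and> (\<forall>u v. E u v \<longrightarrow> u \<in> V \<and> v \<in> V)
     \<and> (\<forall>u v. E u v \<longrightarrow> E v u) \<and> (\<forall>v. \<not> E v v)"

definition connected_on :: "'a set \<Rightarrow> ('a \<Rightarrow> 'a \<Rightarrow> bool) \<Rightarrow> bool" where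
  "connected_on S E \<longleftrightarrow>
     (\<forall>u\<in>S. \<forall>v\<in>S. (\<lambda>x y. E x y \<and> x \<in> S \<and> y \<in> S)\<^sup>*\<^sup>* u v)"

definition two_connected :: "'a set \<Rightarrow> ('a \<Rightarrow> 'a \<Rightarrow> bool) \<Rightarrow> bool" where
  "two_connected V E \<longleftrightarrow> card V \<ge> 3 \<and> connected_on V E
     \<and> (\<forall>v\<in>V. connected_on (V - {v}) E)"

definition is_cycle :: "('a \<Rightarrow> 'a \<Rightarrow> bool) \<Rightarrow> 'a list \<Rightarrow> bool" where
  "is_cycle E c \<longleftrightarrow> length c \<ge> 3 \<and> distinct c
     \<and> (\<forall>i < length c. E (c ! i) (c ! ((i + 1) mod length c)))"

definition is_induced_cycle :: "('a \<Rightarrow> 'a \<Rightarrow> bool) \<Rightarrow> 'a list \<Rightarrow> bool" where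
  "is_induced_cycle E c \<longleftrightarrow> is_cycle E c
     \<and> (\<forall>i < length c. \<forall>j < length c. E (c ! i) (c ! j) \<longrightarrow>
          j = (i + 1) mod length c \<or> i = (j + 1) mod length c)"

definition chordal :: "'a set \<Rightarrow> ('a \<Rightarrow> 'a \<Rightarrow> bool) \<Rightarrow> bool" where
  "chordal V E \<longleftrightarrow> (\<forall>c. set c \<subseteq> V \<longrightarrow> is_induced_cycle E c \<longrightarrow> length c = 3)"

definition is_clique :: "'a set \<Rightarrow> ('a \<Rightarrow> 'a \<Rightarrow> bool) \<Rightarrow> 'a set \<Rightarrow> bool" where
  "is_clique V E C \<longleftrightarrow> C \<subseteq> V \<and> (\<forall>u\<in>C. \<forall>v\<in>C. u \<noteq> v \<longrightarrow> E u v)"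

definition clique_number :: "'a set \<Rightarrow> ('a \<Rightarrow> 'a \<Rightarrow> bool) \<Rightarrow> nat" where
  "clique_number V E = Max {card C | C. is_clique V E C}"

definition is_longest_cycle :: "'a set \<Rightarrow> ('a \<Rightarrow> 'a \<Rightarrow> bool) \<Rightarrow> 'a list \<Rightarrow> bool" where
  "is_longest_cycle V E c \<longleftrightarrow> set c \<subseteq> V \<and> is_cycle E c
     \<and> (\<forall>c'. set c' \<subseteq> V \<longrightarrow> is_cycle E c' \<longrightarrow> length c' \<le> length c)"

definition lct :: "'a set \<Rightarrow> ('a \<Rightarrow> 'a \<Rightarrow> bool) \<Rightarrow> nat" where
  "lct V E = (LEAST k. \<exists>S. S \<subseteq> V \<and> card S = k
      \<and> (\<forall>c. is_longest_cycle V E c \<longrightarrow> S \<inter> set c \<noteq> {}))"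

end

theory Submission
  imports Defs
begin

text \<open>
  Let L be the length of a longest cycle, let k be the clique number, and suppose that every set of
  at most max(1, k - 3) vertices is missed by some longest cycle. For a clique X, an X-ear is a path
  with two distinct ends in X and no inner vertex in X; call it long if it has at least L/2 edges.
  A longest cycle meeting X in at most two vertices yields a long X-ear, and two long X-ears with
  disjoint interiors close up, through edges of X, to a cycle of length at least L, and more than L
  unless they have the same ends and exactly L/2 edges each.

  Choose a smallest connected set B whose neighbourhood X is a clique and which contains the
  interior of a long X-ear. A longest cycle that misses an end of this ear excludes long X-ears
  outside B. By chordality some v in B is adjacent to all of X. Minimality of B now forces every
  longest cycle to meet the clique Y = X + v in at least three vertices, so Y has k \<ge> 4 vertices, and
  every triple in Y is exactly the trace on Y of some longest cycle.

  Finally take a longest Y-ear, from x to y. As Y is a maximum clique, some w in Y has no neighbour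
  in the component containing the interior of the ear. Take a longest cycle whose trace is {x, z, w}
  with z different from y, and replace its segment from x to z by the ear followed by the edge yz.
  The result is a cycle, and since it is not longer, the segment is an ear longer than the longest one.
\<close>

section \<open>Cycles as closed lists, ears, and cutting a cycle at vertices of a set\<close>

lemma successively_join:
  "successively P (xs @ [b]) \<Longrightarrow> successively P (b # ys) \<Longrightarrow> successively P (xs @ b # ys)"
  by (auto simp: successively_append_iff)

text \<open>Closing the list with its own head replaces index arithmetic modulo the length, so that
  cycles can be cut and glued with the append rules for \<open>successively\<close>.\<close>

lemma is_cycle_iff_successively:
  "is_cycle E c \<longleftrightarrow> length c \<ge> 3 \<and> distinct c \<and> successively E (c @ [hd c])"
proof -
  have "(\<forall>i < length c. E (c ! i) (c ! ((i + 1) mod length c))) \<longleftrightarrow> successively E (c @ [hd c])"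
    if "length c \<ge> 3"
  proof -
    have "(c @ [hd c]) ! Suc i = c ! ((i + 1) mod length c)" if "i < length c" for i
    proof (cases "Suc i = length c")
      case True
      then show ?thesis using \<open>length c \<ge> 3\<close> by (cases c) (auto simp: nth_append)
    next
      case False
      then show ?thesis using that by (simp add: nth_append)
    qed
    then show ?thesis by (auto simp: successively_conv_nth nth_append)
  qed
  then show ?thesis by (auto simp: is_cycle_def)
qed

lemma is_cycle_rotate:
  assumes "is_cycle E (xs @ a # ys)"
  shows "is_cycle E (a # ys @ xs)"
  using assms unfolding is_cycle_iff_successively
  by (cases xs) (auto simp: successively_append_iff successively_Cons hd_append split: if_splits)

lemma is_cycle_from:
  assumes "is_cycle E c" "a \<in> set c"
  obtains r where "is_cycle E (a # r)" "set (a # r) = set c" "length (a # r) = length c"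
proof -
  obtain xs ys where c: "c = xs @ a # ys" using assms(2) by (meson split_list)
  show thesis
    by (rule that[of "ys @ xs"]) (use assms(1) is_cycle_rotate c in auto)
qed

text \<open>Only the inner vertices are listed: the ear has \<open>length q + 1\<close> edges, and
  \<open>q = []\<close> is a single edge inside \<open>X\<close>.\<close>

definition ear :: "('a \<Rightarrow> 'a \<Rightarrow> bool) \<Rightarrow> 'a set \<Rightarrow> 'a \<Rightarrow> 'a list \<Rightarrow> 'a \<Rightarrow> bool" where
  "ear E X a q b \<longleftrightarrow> a \<in> X \<and> b \<in> X \<and> a \<noteq> b \<and> distinct q \<and> set q \<inter> X = {}
     \<and> successively E (a # q @ [b])"

lemma ear_reverse:
  assumes "\<And>x y. E x y \<Longrightarrow> E y x" "ear E X a q b"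
  shows "ear E X b (rev q) a"
proof -
  have "successively E (a # q @ [b])" using assms(2) by (simp add: ear_def)
  then have "successively (\<lambda>x y. E y x) (a # q @ [b])"
    by (rule successively_mono) (use assms(1) in auto)
  then have "successively E (rev (a # q @ [b]))" unfolding successively_rev .
  then show ?thesis using assms(2) by (auto simp: ear_def)
qed

lemma cycle_split2:
  assumes "is_cycle E c" "set c \<inter> X = {a, b}" "a \<noteq> b"
  obtains q r where "ear E X a q b" "ear E X b r a" "length q + length r + 2 = length c"
    "set q \<union> set r \<subseteq> set c"
proof -
  have "a \<in> set c" using assms by auto
  then obtain s where s: "is_cycle E (a # s)" "set (a # s) = set c" "length (a # s) = length c"
    using is_cycle_from[OF assms(1)] by blast
  have "b \<in> set s" using assms s by auto
  then obtain q r where qr: "s = q @ b # r" by (meson split_list)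
  have sc: "set c = {a,b} \<union> set q \<union> set r" using s qr by auto
  have d: "distinct (a # q @ b # r)" and su: "successively E (a # (q @ b # r) @ [a])"
    using s(1) unfolding is_cycle_iff_successively qr by auto
  have X: "set q \<inter> X = {}" "set r \<inter> X = {}" using assms(2) sc d by auto
  have su': "successively E (a # q @ [b])" "successively E (b # r @ [a])"
    using su by (auto simp: successively_append_iff successively_Cons hd_append split: if_splits)
  show thesis
    by (rule that[of q r]) (use assms X d su' s qr sc in \<open>auto simp: ear_def\<close>)
qed

text \<open>From \<open>x\<close> the cycle may run through \<open>y\<close> and \<open>z\<close> in
  either order; the wrong order is repaired by traversing it backwards, using the symmetry of
  \<open>E\<close>.\<close>

lemma cycle_split3:
  assumes "is_cycle E c" "\<And>x y. E x y \<Longrightarrow> E y x" "set c \<inter> X = {x, y, z}"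
    "x \<noteq> y" "y \<noteq> z" "x \<noteq> z"
  obtains p q r where "ear E X x p y" "ear E X y q z" "ear E X z r x"
    "length p + length q + length r + 3 = length c"
    "set p \<inter> set q = {}" "set q \<inter> set r = {}" "set p \<inter> set r = {}"
proof -
  have "x \<in> set c" using assms by auto
  then obtain s where s: "is_cycle E (x # s)" "set (x # s) = set c" "length (x # s) = length c"
    using is_cycle_from[OF assms(1)] by blast
  have step: "\<exists>p q r. s = p @ y # q @ z # r \<or> s = p @ z # q @ y # r"
  proof -
    have "y \<in> set c" "z \<in> set c" using assms(3) by blast+
    then have yz: "y \<in> set s" "z \<in> set s" using assms(4,6) s(2) by auto
    then obtain p q where pq: "s = p @ y # q" by (meson split_list)
    with yz assms have "z \<in> set p \<or> z \<in> set q" by auto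
    then show ?thesis
    proof
      assume "z \<in> set q"
      then obtain q1 q2 where "q = q1 @ z # q2" by (meson split_list)
      then show ?thesis using pq by auto
    next
      assume "z \<in> set p"
      then obtain q1 q2 where "p = q1 @ z # q2" by (meson split_list)
      then show ?thesis using pq by auto
    qed
  qed
  have ears: "ear E X x p u \<and> ear E X u q w \<and> ear E X w r x \<and>
     length p + length q + length r + 3 = length c \<and>
     set p \<inter> set q = {} \<and> set q \<inter> set r = {} \<and> set p \<inter> set r = {}"
    if e: "s = p @ u # q @ w # r" and uw: "{u, w} = {y, z}" for p q r u w
  proof -
    have d: "distinct (x # p @ u # q @ w # r)"
      and su: "successively E (x # (p @ u # q @ w # r) @ [x])"
      using s(1) unfolding is_cycle_iff_successively e by auto
    have c: "set p \<subseteq> set c" "set q \<subseteq> set c" "set r \<subseteq> set c" using s e by auto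
    have cX: "set c \<inter> X = {x,u,w}" using assms(3) by (simp add: uw)
    have p: "set p \<inter> {x,u,w} = {}" "set q \<inter> {x,u,w} = {}" "set r \<inter> {x,u,w} = {}"
      using d by auto
    have X: "set p \<inter> X = {}" "set q \<inter> X = {}" "set r \<inter> X = {}" "{x,u,w} \<subseteq> X"
      unfolding cX[symmetric] using c p[folded cX] by blast+
    have "successively E (x # p @ [u])" "successively E (u # q @ [w])" "successively E (w # r @ [x])"
      using su by (auto simp: successively_append_iff successively_Cons hd_append split: if_splits)
    then show ?thesis using X d s(3) e by (auto simp: ear_def)
  qed
  obtain p q r where "s = p @ y # q @ z # r \<or> s = p @ z # q @ y # r" using step by blast
  then show thesis
  proof
    assume "s = p @ y # q @ z # r"
    from ears[OF this] show thesis using that[of p q r] by auto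
  next
    assume "s = p @ z # q @ y # r"
    from ears[OF this] have "ear E X x p z \<and> ear E X z q y \<and> ear E X y r x \<and>
     length p + length q + length r + 3 = length c \<and>
     set p \<inter> set q = {} \<and> set q \<inter> set r = {} \<and> set p \<inter> set r = {}" by auto
    then show thesis using that[of "rev r" "rev q" "rev p"] ear_reverse[of E X, OF assms(2)]
      by (simp add: Int_commute)
  qed
qed

section \<open>Neighbourhoods, connected sets and components\<close>

definition nbhd :: "('a \<Rightarrow> 'a \<Rightarrow> bool) \<Rightarrow> 'a set \<Rightarrow> 'a set" where
  "nbhd E B = {x. x \<notin> B \<and> (\<exists>b\<in>B. E b x)}"

lemma nbhdI: "E b x \<Longrightarrow> b \<in> B \<Longrightarrow> x \<notin> B \<Longrightarrow> x \<in> nbhd E B"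
  by (auto simp: nbhd_def)

text \<open>A walk in \<open>B'\<close> that starts in \<open>B\<close> could leave \<open>B\<close>
  only through a vertex of \<open>nbhd E B\<close>. This is how components belonging to different
  separating sets get nested.\<close>

lemma connected_on_subset_if_nbhd_disjoint:
  assumes "connected_on B' E" "B' \<inter> nbhd E B = {}" "u \<in> B'" "u \<in> B"
  shows "B' \<subseteq> B"
proof
  fix v assume "v \<in> B'"
  then have "(\<lambda>x y. E x y \<and> x \<in> B' \<and> y \<in> B')\<^sup>*\<^sup>* u v"
    using assms by (auto simp: connected_on_def)
  then show "v \<in> B"
    by induction (use assms in \<open>auto simp: nbhd_def\<close>)
qed

lemma successively_rtranclp:
  assumes "successively E q" "set q \<subseteq> B" "q \<noteq> []" "v \<in> set q"
  shows "(\<lambda>x y. E x y \<and> x \<in> B \<and> y \<in> B)\<^sup>*\<^sup>* (hd q) v"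
  using assms
proof (induction q)
  case (Cons a q)
  show ?case
  proof (cases "v = a")
    case False
    then have "q \<noteq> []" "v \<in> set q" using Cons.prems by auto
    with Cons have 1: "(\<lambda>x y. E x y \<and> x \<in> B \<and> y \<in> B)\<^sup>*\<^sup>* (hd q) v"
      by (auto simp: successively_Cons)
    have "E a (hd q)" "hd q \<in> B" "a \<in> B"
      using Cons.prems \<open>q \<noteq> []\<close> by (auto simp: successively_Cons)
    with 1 show ?thesis by (auto intro: converse_rtranclp_into_rtranclp)
  qed simp
qed simp

lemma connected_on_path:
  assumes "connected_on B E" "u \<in> B" "v \<in> B"
  obtains p where "p \<noteq> []" "hd p = u" "last p = v" "set p \<subseteq> B" "successively E p"
proof -
  have "(\<lambda>x y. E x y \<and> x \<in> B \<and> y \<in> B)\<^sup>*\<^sup>* u v"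
    using assms by (auto simp: connected_on_def)
  then have "\<exists>p. p \<noteq> [] \<and> hd p = u \<and> last p = v \<and> set p \<subseteq> B \<and> successively E p"
  proof induction
    case base
    show ?case by (rule exI[of _ "[u]"]) (use assms in auto)
  next
    case (step y z)
    then obtain p where "p \<noteq> []" "hd p = u" "last p = y" "set p \<subseteq> B" "successively E p" by blast
    then show ?case using step
      by (intro exI[of _ "p @ [z]"]) (auto simp: successively_append_iff)
  qed
  then show thesis using that by blast
qed

lemma is_clique_subset: "is_clique V E C \<Longrightarrow> D \<subseteq> C \<Longrightarrow> is_clique V E D"
  unfolding is_clique_def by blast

locale sgraph =
  fixes V :: "'a set" and E :: "'a \<Rightarrow> 'a \<Rightarrow> bool"
  assumes simple: "simple_graph V E"
begin

lemma adj_sym: "E u v \<Longrightarrow> E v u"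
  and adj_V: "E u v \<Longrightarrow> u \<in> V" "E u v \<Longrightarrow> v \<in> V"
  and not_adj_self: "\<not> E v v"
  and finV: "finite V"
  using simple by (auto simp: simple_graph_def)

lemma ear_rev: "ear E X a q b \<Longrightarrow> ear E X b (rev q) a"
  by (rule ear_reverse) (rule adj_sym)

lemma ear_V: "ear E X a q b \<Longrightarrow> set q \<subseteq> V"
proof
  fix z assume e: "ear E X a q b" and "z \<in> set q"
  then obtain xs ys where "q = xs @ z # ys" by (meson split_list)
  then have "E z (hd (ys @ [b]))"
    using e by (cases ys) (auto simp: ear_def successively_append_iff successively_Cons)
  then show "z \<in> V" using adj_V by blast
qed

lemma cycle_V: "is_cycle E c \<Longrightarrow> set c \<subseteq> V"
  using adj_V by (fastforce simp: is_cycle_def in_set_conv_nth)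

lemma nbhd_V: "nbhd E B \<subseteq> V"
  using adj_V by (auto simp: nbhd_def)

text \<open>\<open>B\<close> is the component of \<open>V - X\<close> that contains the path; a
  neighbour of \<open>B\<close> outside \<open>X\<close> would itself be reachable.\<close>

lemma component_exists:
  assumes "successively E q" "q \<noteq> []" "set q \<subseteq> V" "set q \<inter> X = {}"
  obtains B where "connected_on B E" "B \<subseteq> V" "B \<inter> X = {}" "nbhd E B \<subseteq> X" "set q \<subseteq> B"
proof -
  let ?R = "\<lambda>x y. E x y \<and> x \<in> V - X \<and> y \<in> V - X"
  define B where "B = {u. ?R\<^sup>*\<^sup>* (hd q) u}"
  have h: "hd q \<in> V - X" using assms by (metis DiffI disjoint_iff hd_in_set subsetD)
  have BV: "B \<subseteq> V - X"
  proof
    fix u assume "u \<in> B"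
    then have "?R\<^sup>*\<^sup>* (hd q) u" by (simp add: B_def)
    then show "u \<in> V - X" by induction (use h in auto)
  qed
  let ?S = "\<lambda>x y. E x y \<and> x \<in> B \<and> y \<in> B"
  \<comment> \<open>The walks defining \<open>B\<close> run in \<open>V - X\<close>, but all their
    vertices are reachable from \<open>hd q\<close>, so they run in \<open>B\<close>, as
    \<open>connected_on\<close> demands.\<close>
  have S: "?S\<^sup>*\<^sup>* (hd q) u" if "u \<in> B" for u
  proof -
    have "?R\<^sup>*\<^sup>* (hd q) u" using that by (simp add: B_def)
    then show ?thesis
    proof induction
      case (step y z)
      then have "y \<in> B" "z \<in> B" by (auto simp: B_def intro: rtranclp.rtrancl_into_rtrancl)
      with step show ?case by (auto intro: rtranclp.rtrancl_into_rtrancl)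
    qed simp
  qed
  have "symp ?S" using adj_sym by (auto simp: symp_def)
  then have "symp ?S\<^sup>*\<^sup>*" by (rule symp_rtranclp)
  then have conn: "connected_on B E"
    unfolding connected_on_def using S by (meson rtranclp_trans sympD)
  have nb: "nbhd E B \<subseteq> X"
  proof
    fix x assume "x \<in> nbhd E B"
    then obtain b where b: "b \<in> B" "E b x" "x \<notin> B" by (auto simp: nbhd_def)
    then have "\<not> ?R b x" by (auto simp: B_def intro: rtranclp.rtrancl_into_rtrancl)
    then show "x \<in> X" using b BV adj_V by auto
  qed
  have "set q \<subseteq> B"
    using successively_rtranclp[OF assms(1), of "V - X"] assms unfolding B_def by blast
  with conn nb BV show thesis using that by blast
qed

lemma ear_component:
  assumes e: "ear E X a q b" and "q \<noteq> []"
  obtains B where "connected_on B E" "B \<subseteq> V" "B \<inter> X = {}" "nbhd E B \<subseteq> X" "set q \<subseteq> B"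
    "a \<in> nbhd E B" "b \<in> nbhd E B"
proof -
  have s: "successively E q" "E a (hd q)" "E (last q) b" "set q \<inter> X = {}" "a \<in> X" "b \<in> X"
    using assms by (auto simp: ear_def successively_append_iff successively_Cons)
  obtain B where B: "connected_on B E" "B \<subseteq> V" "B \<inter> X = {}" "nbhd E B \<subseteq> X" "set q \<subseteq> B"
    using component_exists[OF s(1) assms(2) ear_V[OF e] s(4)] by metis
  have "hd q \<in> B" "last q \<in> B" using B(5) \<open>q \<noteq> []\<close> by auto
  moreover have "a \<notin> B" "b \<notin> B" using s(5,6) B(3) by auto
  ultimately have "a \<in> nbhd E B" "b \<in> nbhd E B" using s(2,3) adj_sym by (auto intro: nbhdI)
  with B show thesis using that by blast
qed

text \<open>A cycle without one of its vertices is still a path, so what remains outside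
  \<open>X\<close> lies in one component, and the vertex left out, if any, is adjacent to that
  path.\<close>

lemma cycle_component:
  assumes c: "is_cycle E c" and le: "card (set c \<inter> X) \<le> 1"
  obtains B where "connected_on B E" "B \<subseteq> V" "B \<inter> X = {}" "nbhd E B \<subseteq> X"
    "set c \<subseteq> B \<union> nbhd E B" "set c \<inter> B \<noteq> {}"
proof (cases "set c \<inter> X = {}")
  case True
  have "successively E c" "c \<noteq> []" 
    using c by (auto simp: is_cycle_iff_successively successively_append_iff)
  then obtain B where "connected_on B E" "B \<subseteq> V" "B \<inter> X = {}" "nbhd E B \<subseteq> X" "set c \<subseteq> B"
    using component_exists cycle_V[OF c] True by metis
  with \<open>c \<noteq> []\<close> show thesis by (intro that[of B]) (auto simp: neq_Nil_conv)
next
  case False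
  then obtain x where x: "x \<in> set c" "x \<in> X" by auto
  then have sx: "set c \<inter> X = {x}"
    using le by (metis IntI List.finite_set False card_1_singletonE card_eq_0_iff finite_Int
        le_antisym less_one linorder_not_le singletonD)
  obtain s where s: "is_cycle E (x # s)" "set (x # s) = set c"
    using is_cycle_from[OF c x(1)] by metis
  have sq: "successively E s" "s \<noteq> []" "E x (hd s)" "x \<notin> set s"
  proof -
    obtain h t where "s = h # t" using s(1) by (cases s) (auto simp: is_cycle_def)
    then show "successively E s" "s \<noteq> []" "E x (hd s)" "x \<notin> set s"
      using s(1) by (auto simp: is_cycle_iff_successively successively_append_iff successively_Cons
          hd_append split: if_splits)
  qed
  have "set s \<subseteq> V" "set s \<inter> X = {}" using cycle_V[OF c] s sx sq by auto
  then obtain B where B: "connected_on B E" "B \<subseteq> V" "B \<inter> X = {}" "nbhd E B \<subseteq> X" "set s \<subseteq> B"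
    using component_exists[OF sq(1,2)] by metis
  have "x \<in> nbhd E B"
    using nbhdI[of E "hd s" x B] sq adj_sym B x by (metis IntI empty_iff hd_in_set subsetD)
  then have "set c \<subseteq> B \<union> nbhd E B" using s(2) B by auto
  moreover have "hd s \<in> set c \<inter> B" using s(2) B(5) sq(2) by (metis IntI hd_in_set list.set_intros(2) subsetD)
  ultimately have "set c \<subseteq> B \<union> nbhd E B" "set c \<inter> B \<noteq> {}" by blast+
  with B show thesis using that by blast
qed

section \<open>Closing two disjoint ears to a cycle\<close>

lemma join_ears_same_ends:
  assumes "ear E X a q b" "ear E X a r b" "set q \<inter> set r = {}" "length q + length r \<ge> 1"
  shows "is_cycle E (a # q @ b # rev r)"
proof -
  have "successively E ((a # q) @ [b])" "successively E (b # (rev r @ [a]))"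
    using assms(1) ear_rev[OF assms(2)] by (simp_all add: ear_def)
  from successively_join[OF this] have "successively E ((a # q @ b # rev r) @ [a])" by simp
  moreover have "distinct (a # q @ b # rev r)" using assms by (auto simp: ear_def)
  ultimately show ?thesis using assms(4) by (simp add: is_cycle_iff_successively)
qed

lemma join_ears_one_end:
  assumes "ear E X a q b" "ear E X c r b" "set q \<inter> set r = {}" "a \<noteq> c" "E c a"
  shows "is_cycle E (a # q @ b # rev r @ [c])"
proof -
  have "successively E ((a # q) @ [b])" "successively E ((b # rev r) @ [c])" "successively E (c # [a])"
    using assms(1,5) ear_rev[OF assms(2)] by (simp_all add: ear_def)
  from successively_join[OF this(2,3)] successively_join[OF this(1)]
  have "successively E ((a # q @ b # rev r @ [c]) @ [a])" by simp
  moreover have "distinct (a # q @ b # rev r @ [c])" using assms by (auto simp: ear_def)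
  ultimately show ?thesis by (simp add: is_cycle_iff_successively)
qed

lemma join_ears_no_end:
  assumes "ear E X a q b" "ear E X c r d" "set q \<inter> set r = {}" "{a, b} \<inter> {c, d} = {}"
    "E b c" "E d a"
  shows "is_cycle E (a # q @ b # c # r @ [d])"
proof -
  have "successively E ((a # q) @ [b])" "successively E ((c # r) @ [d])" "successively E (d # [a])"
    using assms by (simp_all add: ear_def)
  from successively_join[OF this(2,3)] successively_join[OF this(1), of "c # r @ [d, a]"]
  have "successively E ((a # q @ b # c # r @ [d]) @ [a])" using assms(5) by simp
  moreover have "distinct (a # q @ b # c # r @ [d])" using assms by (auto simp: ear_def)
  ultimately show ?thesis by (simp add: is_cycle_iff_successively)
qed

text \<open>A shared end closes up directly; elsewhere an edge of the clique links two ends. Besides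
  the inner vertices the cycle has two, three or four ends, according to whether both, one or none
  are shared; hence the strict bound for different pairs of ends.\<close>

lemma join_ears:
  assumes cl: "is_clique V E X" and e: "ear E X a q b" "ear E X c r d"
    and disj: "set q \<inter> set r = {}" "length q + length r \<ge> 1"
  obtains s where "is_cycle E s" "length s \<ge> length q + length r + 2"
    "{a, b} \<noteq> {c, d} \<Longrightarrow> length s > length q + length r + 2"
proof -
  have X: "a \<in> X" "b \<in> X" "c \<in> X" "d \<in> X" "a \<noteq> b" "c \<noteq> d" using e by (auto simp: ear_def)
  have adj: "E u v" if "u \<in> X" "v \<in> X" "u \<noteq> v" for u v
    using cl that by (auto simp: is_clique_def)
  note e' = ear_rev[OF e(1)] ear_rev[OF e(2)]
  consider "a = c" "b = d" | "a = d" "b = c" | "a = c" "b \<noteq> d" | "a = d" "b \<noteq> c"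
    | "b = c" "a \<noteq> d" | "b = d" "a \<noteq> c" | "{a, b} \<inter> {c, d} = {}" by blast
  then show thesis
  proof cases
    case 1
    with join_ears_same_ends[of X a q b r] e disj show thesis using that by fastforce
  next
    case 2
    with join_ears_same_ends[of X a q b "rev r"] e e' disj show thesis using that by fastforce
  next
    case 3
    with join_ears_one_end[of X b "rev q" a d "rev r"] e e' disj adj[of d b] X
    show thesis using that by fastforce
  next
    case 4
    with join_ears_one_end[of X b "rev q" a c "r"] e e' disj adj[of c b] X
    show thesis using that by fastforce
  next
    case 5
    with join_ears_one_end[of X a q b d "rev r"] e e' disj adj[of d a] X
    show thesis using that by fastforce
  next
    case 6
    with join_ears_one_end[of X a q b c "r"] e e' disj adj[of c a] X
    show thesis using that by fastforce
  next
    case 7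
    with join_ears_no_end[of X a q b c r d] e disj adj[of b c] adj[of d a] X
    show thesis using that by fastforce
  qed
qed

end

section \<open>Chordality and dominating vertices\<close>

locale chordal_graph = sgraph +
  assumes chordal: "chordal V E"
begin

text \<open>Adjacency is prescribed for \<open>i < j\<close> only, the closing edge being the pair
  of first and last position; symmetry and the absence of loops supply the modular form of
  \<open>is_induced_cycle\<close>.\<close>

lemma no_long_induced_cycle:
  assumes "length p \<ge> 4" "distinct p"
    and ind: "\<And>i j. i < j \<Longrightarrow> j < length p \<Longrightarrow>
      E (p ! i) (p ! j) \<longleftrightarrow> j = Suc i \<or> (i = 0 \<and> Suc j = length p)"
  shows False
proof -
  let ?n = "length p"
  have adj: "E (p ! i) (p ! ((i + 1) mod ?n))" if "i < ?n" for i
  proof (cases "Suc i = ?n")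
    case True
    then show ?thesis using ind[of 0 i] assms(1) adj_sym by auto
  next
    case False
    then show ?thesis using ind[of i "Suc i"] that by auto
  qed
  then have cyc: "is_cycle E p" using assms by (auto simp: is_cycle_def)
  have "j = (i + 1) mod ?n \<or> i = (j + 1) mod ?n"
    if "i < ?n" "j < ?n" "E (p ! i) (p ! j)" for i j
  proof -
    consider "i < j" | "j < i" | "i = j" by linarith
    then show ?thesis
    proof cases
      case 1
      then show ?thesis using ind[of i j] that by auto
    next
      case 2
      then show ?thesis using ind[of j i] that adj_sym by auto
    next
      case 3
      then show ?thesis using that not_adj_self by auto
    qed
  qed
  with cyc have "is_induced_cycle E p" by (auto simp: is_induced_cycle_def)
  then show False using chordal cycle_V[OF cyc] assms(1) by (auto simp: chordal_def)
qed

text \<open>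
  A vertex v of B with the most neighbours in X works: if it misses x, the end of a shortest path in B
  from v to the neighbours of x sees x and, as there are no long induced cycles, everything v sees.
\<close>

lemma dominating_vertex:
  assumes B: "connected_on B E" "B \<subseteq> V" "B \<noteq> {}" and X: "X \<subseteq> nbhd E B" "is_clique V E X"
  obtains v where "v \<in> B" "\<And>x. x \<in> X \<Longrightarrow> E v x"
proof -
  define f where "f v = card {x \<in> X. E v x}" for v
  have "finite B" "finite X" using B X finV by (auto simp: is_clique_def intro: finite_subset)
  then have "Max (f ` B) \<in> f ` B" using B(3) by auto
  then obtain v where v: "v \<in> B" "Max (f ` B) = f v" by auto
  then have vmax: "f u \<le> f v" if "u \<in> B" for u
    using Max_ge[of "f ` B" "f u"] \<open>finite B\<close> that by auto
  have "E v x" if x: "x \<in> X" for x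
  proof (rule ccontr)
    assume nvx: "\<not> E v x"
    \<comment> \<open>\<open>P\<close> describes walks in \<open>B\<close> from \<open>v\<close> to
      a neighbour of \<open>x\<close>; distinctness will come from taking a shortest one.\<close>
    define P where "P p \<longleftrightarrow> p \<noteq> [] \<and> hd p = v \<and> set p \<subseteq> B \<and> successively E p \<and> E (last p) x" for p
    obtain b where b: "b \<in> B" "E b x" using x X by (auto simp: nbhd_def)
    obtain p0 where "P p0"
      using connected_on_path[OF B(1) v(1) b(1)] b(2) unfolding P_def by metis
    then obtain p where p: "P p" and pmin: "\<And>p'. P p' \<Longrightarrow> length p \<le> length p'"
      using ex_has_least_nat[of P p0 length] by blast
    note pp = p[unfolded P_def]
    have xB: "z \<notin> B" if "z \<in> X" for z using X(1) that by (auto simp: nbhd_def)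
    \<comment> \<open>For these three facts: stopping at an earlier neighbour of \<open>x\<close>,
      shortcutting a chord, or cutting out a closed piece would give a shorter walk satisfying
      \<open>P\<close>.\<close>
    have F1: "Suc i = length p" if "i < length p" "E (p ! i) x" for i
    proof -
      have "successively E (take (Suc i) p)"
        using pp by (auto simp: successively_conv_nth)
      then have "P (take (Suc i) p)"
        unfolding P_def using pp that
        by (auto simp: take_Suc_conv_app_nth hd_append hd_conv_nth dest: in_set_takeD)
      from pmin[OF this] that show ?thesis by auto
    qed
    have F2: "j \<le> Suc i" if "i < j" "j < length p" "E (p ! i) (p ! j)" for i j
    proof -
      have "successively E (take (Suc i) p)" "successively E (drop j p)"
        using pp by (auto simp: successively_conv_nth)
      then have "P (take (Suc i) p @ drop j p)"
        unfolding P_def using pp that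
        by (auto simp: successively_append_iff successively_Cons take_Suc_conv_app_nth
            hd_append hd_conv_nth hd_drop_conv_nth dest: in_set_takeD in_set_dropD)
      from pmin[OF this] that show ?thesis by auto
    qed
    have F3: "p ! i \<noteq> p ! j" if "i < j" "j < length p" for i j
    proof
      assume eq: "p ! i = p ! j"
      have "successively E (take (Suc i) p)" "successively E (drop (Suc j) p)"
        using pp by (auto simp: successively_conv_nth)
      moreover have "E (p ! j) (p ! Suc j)" if "Suc j < length p"
        using pp that by (auto simp: successively_conv_nth)
      moreover have "E (p ! j) x" if "Suc j = length p"
        using pp that by (metis diff_Suc_1 last_conv_nth)
      ultimately have "P (take (Suc i) p @ drop (Suc j) p)"
        unfolding P_def using pp that eq
        by (auto simp: successively_append_iff successively_Cons take_Suc_conv_app_nth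
            hd_append hd_conv_nth hd_drop_conv_nth dest: in_set_takeD in_set_dropD)
      from pmin[OF this] that show False by auto
    qed
    have dp: "distinct p" unfolding distinct_conv_nth
      using F3 by (metis linorder_neqE_nat)
    define m where "m = length p - 1"
    have lp: "length p = Suc m" using pp by (auto simp: m_def)
    have last: "last p = p ! m" using pp by (simp add: last_conv_nth m_def)
    have v0: "p ! 0 = v" using pp by (metis hd_conv_nth)
    have m1: "m \<ge> 1"
    proof (rule ccontr)
      assume "\<not> m \<ge> 1"
      then have "m = 0" by simp
      then show False using pp nvx last v0 by auto
    qed
    have dom: "E (last p) y" if y: "y \<in> X" "E v y" for y
    proof (rule ccontr)
      assume ny: "\<not> E (last p) y"
      \<comment> \<open>Position 0 carries \<open>v\<close>, which sees \<open>y\<close>. For the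
        last position \<open>i\<close> that sees \<open>y\<close>, the vertex \<open>y\<close>, the
        rest of \<open>p\<close> from \<open>i\<close> on, and \<open>x\<close> form an induced
        cycle of length \<open>m - i + 3\<close>, which is at least 4 because \<open>last p\<close>
        misses \<open>y\<close>.\<close>
      define I where "I = {i. i < length p \<and> E (p ! i) y}"
      have "0 \<in> I" using y v0 lp by (auto simp: I_def)
      have finI: "finite I" by (simp add: I_def)
      define i where "i = Max I"
      have "i \<in> I" using \<open>0 \<in> I\<close> finI unfolding i_def by (auto intro: Max_in)
      then have i: "i < length p" "E (p ! i) y" by (auto simp: I_def)
      have imax: "j \<le> i" if "j < length p" "E (p ! j) y" for j
        using that finI unfolding i_def by (auto simp: I_def)
      have im: "i < m" using i ny last lp by (metis less_antisym)
      have "x \<noteq> y" using y nvx by auto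
      then have "E y x" using X(2) y x by (auto simp: is_clique_def)
      define c where "c = y # drop i p @ [x]"
      have len: "length c = m - i + 3" using im lp by (simp add: c_def)
      have c0: "c ! 0 = y" by (simp add: c_def)
      have cl: "c ! Suc l = p ! (i + l)" if "l \<le> m - i" for l
        using that im lp by (auto simp: c_def nth_append)
      have cx: "c ! (m - i + 2) = x" using im lp by (auto simp: c_def nth_append)
      show False
      proof (rule no_long_induced_cycle[of c])
        show "length c \<ge> 4" using len im by simp
        show "distinct c"
          using dp xB y x pp \<open>x \<noteq> y\<close> by (auto simp: c_def dest: in_set_dropD)
        fix s t assume st: "s < t" "t < length c"
        show "E (c ! s) (c ! t) \<longleftrightarrow> t = Suc s \<or> (s = 0 \<and> Suc t = length c)"
        proof (cases "t = m - i + 2")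
          case True
          show ?thesis
          proof (cases s)
            case 0
            then show ?thesis using True cx c0 \<open>E y x\<close> len by auto
          next
            case (Suc l)
            then have "l \<le> m - i" using st True by auto
            then have "E (p ! (i + l)) x \<longleftrightarrow> i + l = m"
              using F1[of "i + l"] lp im pp last by auto
            then show ?thesis using Suc True cx cl[of l] \<open>l \<le> m - i\<close> len im by auto
          qed
        next
          case False
          then obtain k where k: "t = Suc k" "k \<le> m - i"
            using st len by (cases t) auto
          show ?thesis
          proof (cases s)
            case 0
            have "E y (p ! (i + k)) \<longleftrightarrow> k = 0"
              using imax[of "i + k"] i(2) k lp im adj_sym by auto
            then show ?thesis using 0 k c0 cl len by auto
          next
            case (Suc l)
            have "E (p ! (i + l)) (p ! (i + k)) \<longleftrightarrow> k = Suc l"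
            proof
              assume "E (p ! (i + l)) (p ! (i + k))"
              moreover have "i + k < length p" "l < k" using Suc k st lp im by auto
              ultimately show "k = Suc l" using F2[of "i + l" "i + k"] by auto
            next
              assume "k = Suc l"
              moreover have "i + k < length p" using k lp im by auto
              ultimately show "E (p ! (i + l)) (p ! (i + k))"
                using pp by (auto simp: successively_conv_nth)
            qed
            then show ?thesis using Suc k st cl[of k] cl[of l] by auto
          qed
        qed
      qed
    qed
    have "{y \<in> X. E v y} \<subset> {y \<in> X. E (last p) y}" using dom x nvx pp by auto
    then have "f v < f (last p)" unfolding f_def using \<open>finite X\<close> by (auto intro: psubset_card_mono)
    moreover have "last p \<in> B" using pp by (meson last_in_set subsetD)
    ultimately show False using vmax[of "last p"] by auto
  qed
  with v that show thesis by blast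
qed

end

section \<open>Long ears in 2-connected chordal graphs\<close>

locale two_connected_chordal_graph = chordal_graph +
  assumes two_connected: "two_connected V E"
begin

text \<open>Deleting at most one vertex leaves the graph connected, so fewer than two vertices
  cannot separate \<open>B\<close> from \<open>y\<close>.\<close>

lemma card_nbhd_ge_2:
  assumes "u \<in> B" "B \<subseteq> V" "y \<in> V" "y \<notin> B" "y \<notin> nbhd E B"
  shows "card (nbhd E B) \<ge> 2"
proof (rule ccontr)
  assume "\<not> card (nbhd E B) \<ge> 2"
  then have "card (nbhd E B) = 0 \<or> card (nbhd E B) = 1" by linarith
  moreover have "finite (nbhd E B)" using nbhd_V finV finite_subset by blast
  ultimately consider "nbhd E B = {}" | z where "nbhd E B = {z}"
    by (metis card_0_eq card_1_singletonE)
  then have "connected_on (V - nbhd E B) E"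
  proof cases
    case 1
    then show ?thesis using two_connected by (auto simp: two_connected_def)
  next
    case 2
    then have "z \<in> V" using nbhd_V by blast
    then show ?thesis using two_connected 2 by (auto simp: two_connected_def)
  qed
  moreover have "u \<in> V - nbhd E B" using assms by (auto simp: nbhd_def)
  ultimately have "V - nbhd E B \<subseteq> B"
    using connected_on_subset_if_nbhd_disjoint[of "V - nbhd E B" E B u] assms(1) by auto
  then show False using assms by auto
qed

text \<open>The two ears into which \<open>a\<close> and \<open>b\<close> cut the cycle have
  \<open>length c\<close> edges together, so the longer one has at least half of them.\<close>

lemma cycle_long_ear:
  assumes "is_cycle E c" "set c \<inter> X = {a, b}" "a \<noteq> b"
  obtains q where "ear E X a q b" "length c \<le> 2 * (length q + 1)" "set q \<subseteq> set c"
proof -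
  obtain q r where qr: "ear E X a q b" "ear E X b r a" "length q + length r + 2 = length c"
    "set q \<union> set r \<subseteq> set c" using cycle_split2[OF assms] by metis
  show thesis
  proof (cases "length q \<ge> length r")
    case True
    then show thesis using qr that[of q] by auto
  next
    case False
    then show thesis using qr that[of "rev r"] ear_rev by auto
  qed
qed

text \<open>
  Chordality replaces Menger's theorem here: as long as the cycle meets the neighbourhood of B in at
  most one vertex, move the clique towards the cycle through a dominating vertex of B.
\<close>

lemma ear_around_cycle:
  assumes c: "is_cycle E c"
    and "connected_on B E" "B \<subseteq> V" "is_clique V E (nbhd E B)" "card (nbhd E B) \<ge> 2"
      "set c \<subseteq> B \<union> nbhd E B" "card (set c \<inter> nbhd E B) \<le> 1"
  shows "\<exists>a q b. ear E (nbhd E B) a q b \<and> set q \<subseteq> B \<and> length c < 2 * (length q + 1)"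
  using assms(2-)
proof (induction "card B" arbitrary: B rule: less_induct)
  case less
  note B = less.prems
  let ?X = "nbhd E B"
  have finX: "finite ?X" using B(4) card.infinite by fastforce
  have other: "\<exists>x\<in>?X. x \<noteq> z" for z
  proof (rule ccontr)
    assume "\<not> (\<exists>x\<in>?X. x \<noteq> z)"
    then have "?X \<subseteq> {z}" by auto
    then have "card ?X \<le> 1" using card_mono[of "{z}" ?X] by simp
    then show False using B(4) by simp
  qed
  have "B \<noteq> {}" using B(4) by (auto simp: nbhd_def)
  then obtain v where v: "v \<in> B" "\<And>x. x \<in> ?X \<Longrightarrow> E v x"
    using dominating_vertex[OF B(1,2)] B(3) by blast
  let ?Y = "insert v ?X"
  have vX: "v \<notin> ?X" using v by (auto simp: nbhd_def)
  have clY: "is_clique V E ?Y" using B(3) v adj_sym B(2) by (auto simp: is_clique_def)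
  \<comment> \<open>An ear of \<open>Y\<close> ending in \<open>v\<close> is prolonged by an edge
    from \<open>v\<close> to another vertex of \<open>X\<close>. When the cycle meets
    \<open>Y\<close> in two vertices, this additional edge makes the length bound strict.\<close>
  have extend: "\<exists>x. ear E ?X z (q @ [v]) x \<and> set (q @ [v]) \<subseteq> B"
    if e: "ear E ?Y z q v" and q: "set q \<subseteq> B" for z q
  proof -
    have z: "z \<in> ?X" using e by (auto simp: ear_def)
    obtain x where x: "x \<in> ?X" "x \<noteq> z" using other by blast
    have "ear E ?X z (q @ [v]) x"
      using e z x vX v(2)[OF x(1)]
      by (auto simp: ear_def successively_append_iff successively_Cons hd_append split: if_splits)
    then show ?thesis using q v by auto
  qed
  show ?case
  proof (cases "card (set c \<inter> ?Y) \<le> 1")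
    case False
    have "card (set c \<inter> ?Y) \<le> Suc (card (set c \<inter> ?X))"
      by (simp add: Int_insert_right card_insert_if)
    with False B(6) have one: "card (set c \<inter> ?X) = 1" and vc: "v \<in> set c" by (auto simp: Int_insert_right split: if_splits)
    then obtain z where z: "set c \<inter> ?X = {z}" using card_1_singletonE by blast
    then have "set c \<inter> ?Y = {z, v}" "z \<noteq> v" using vc vX by auto
    then obtain q where q: "ear E ?Y z q v" "length c \<le> 2 * (length q + 1)" "set q \<subseteq> set c"
      using cycle_long_ear[OF c] by metis
    then have "set q \<subseteq> B" using B(5) by (auto simp: ear_def)
    with extend[OF q(1)] obtain x where "ear E ?X z (q @ [v]) x" "set (q @ [v]) \<subseteq> B" by blast
    then show ?thesis using q(2) by (intro exI[of _ z] exI[of _ "q @ [v]"] exI[of _ x]) auto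
  next
    case True
    \<comment> \<open>The cycle now sits around a component \<open>B'\<close> of the complement of
      \<open>Y\<close>; as it lies in \<open>B\<close> and lacks \<open>v\<close>, it is smaller
      than \<open>B\<close> and the induction applies.\<close>
    then obtain B' where B': "connected_on B' E" "B' \<subseteq> V" "B' \<inter> ?Y = {}" "nbhd E B' \<subseteq> ?Y"
      "set c \<subseteq> B' \<union> nbhd E B'" "set c \<inter> B' \<noteq> {}" using cycle_component[OF c] by metis
    obtain u where u: "u \<in> set c" "u \<in> B'" using B'(6) by auto
    have "u \<in> B" using u B'(3) B(5) by auto
    then have sub: "B' \<subseteq> B"
      using connected_on_subset_if_nbhd_disjoint[OF B'(1) _ u(2)] B'(3) by blast
    then have "B' \<subset> B" using v B'(3) by auto
    then have "card B' < card B" using B(2) finV by (meson finite_subset psubset_card_mono)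
    \<comment> \<open>Either \<open>B'\<close> sees all of \<open>Y\<close>, or
      \<open>nbhd E B'\<close> separates it from a vertex of \<open>Y\<close>.\<close>
    moreover have "card (nbhd E B') \<ge> 2"
    proof (cases "nbhd E B' = ?Y")
      case True
      then show ?thesis using B(4) finX vX by simp
    next
      case False
      then obtain y where "y \<in> ?Y" "y \<notin> nbhd E B'" using B'(4) by auto
      then show ?thesis using card_nbhd_ge_2[of u B' y] u B'(2,3) clY
        by (auto simp: is_clique_def)
    qed
    moreover have "is_clique V E (nbhd E B')" using is_clique_subset[OF clY B'(4)] .
    moreover have "card (set c \<inter> nbhd E B') \<le> 1"
      using True B'(4) card_mono[of "set c \<inter> ?Y" "set c \<inter> nbhd E B'"] by fastforce
    ultimately obtain a q b where e: "ear E (nbhd E B') a q b" "set q \<subseteq> B'"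
      "length c < 2 * (length q + 1)"
      using less.hyps[of B'] B'(1,2,5) by blast
    have qY: "set q \<inter> ?Y = {}" using e(2) B'(3) by auto
    have eY: "ear E ?Y a q b" using e(1) B'(4) qY by (auto simp: ear_def)
    \<comment> \<open>The ear found for \<open>B'\<close> has its ends in \<open>Y\<close>; if one
      of them is \<open>v\<close>, it is prolonged so as to end in \<open>X\<close>.\<close>
    consider "b = v" | "a = v" | "a \<in> ?X" "b \<in> ?X" using eY by (auto simp: ear_def)
    then show ?thesis
    proof cases
      case 1
      then obtain x where "ear E ?X a (q @ [v]) x" "set (q @ [v]) \<subseteq> B"
        using extend[of a q] eY e(2) sub by auto
      then show ?thesis using e(3) by (intro exI[of _ a] exI[of _ "q @ [v]"] exI[of _ x]) auto
    next
      case 2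
      then obtain x where "ear E ?X b (rev q @ [v]) x" "set (rev q @ [v]) \<subseteq> B"
        using extend[of b "rev q"] ear_rev[OF eY] e(2) sub by auto
      then show ?thesis using e(3) by (intro exI[of _ b] exI[of _ "rev q @ [v]"] exI[of _ x]) auto
    next
      case 3
      then have "ear E ?X a q b" using eY by (auto simp: ear_def)
      then show ?thesis using e sub by blast
    qed
  qed
qed

text \<open>Two common vertices cut the cycle into two ears; with fewer, the cycle sits around a
  component of the complement of \<open>X\<close> and \<open>ear_around_cycle\<close> applies. The
  last alternative controls equality: an ear with exactly half the edges has the trace of the cycle
  on \<open>X\<close> as its ends.\<close>

lemma long_ear_exists:
  assumes X: "is_clique V E X" "card X \<ge> 2" and c: "is_cycle E c" "card (set c \<inter> X) \<le> 2"
  obtains a q b where "ear E X a q b" "length c \<le> 2 * (length q + 1)"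
    "set c \<inter> X = {a, b} \<or> length c < 2 * (length q + 1)"
proof (cases "card (set c \<inter> X) = 2")
  case True
  then obtain a b where ab: "set c \<inter> X = {a, b}" "a \<noteq> b" by (meson card_2_iff)
  then show thesis using cycle_long_ear[OF c(1) ab] that by metis
next
  case False
  then have le: "card (set c \<inter> X) \<le> 1" using c(2) by simp
  obtain B where B: "connected_on B E" "B \<subseteq> V" "B \<inter> X = {}" "nbhd E B \<subseteq> X"
      "set c \<subseteq> B \<union> nbhd E B" "set c \<inter> B \<noteq> {}"
    using cycle_component[OF c(1) le] by metis
  have "card (nbhd E B) \<ge> 2"
  proof (cases "nbhd E B = X")
    case False
    then obtain y where "y \<in> X" "y \<notin> nbhd E B" using B(4) by auto
    moreover obtain u where "u \<in> B" using B(6) by auto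
    ultimately show ?thesis using card_nbhd_ge_2[of u B y] B(2,3) X(1) by (auto simp: is_clique_def)
  qed (use X in simp)
  moreover have "is_clique V E (nbhd E B)" using is_clique_subset[OF X(1) B(4)] .
  moreover have "card (set c \<inter> nbhd E B) \<le> 1"
    using le B(4) card_mono[of "set c \<inter> X" "set c \<inter> nbhd E B"] by fastforce
  ultimately obtain a q b where e: "ear E (nbhd E B) a q b" "set q \<subseteq> B"
    "length c < 2 * (length q + 1)"
    using ear_around_cycle[OF c(1)] B by blast
  then have "ear E X a q b" using B(3,4) by (auto simp: ear_def)
  then show thesis using that e(3) by auto
qed

section \<open>Longest cycles against a maximum clique\<close>

lemma card_clique_le: "is_clique V E C \<Longrightarrow> card C \<le> clique_number V E"
proof -
  assume "is_clique V E C"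
  moreover have "finite {card C | C. is_clique V E C}"
    by (rule finite_subset[of _ "card ` Pow V"]) (use finV in \<open>auto simp: is_clique_def\<close>)
  ultimately show ?thesis unfolding clique_number_def by (intro Max_ge) auto
qed

lemma small_longest_cycle_transversal:
  obtains S where "S \<subseteq> V" "card S \<le> max 1 (clique_number V E - 3)"
    "\<And>c. is_longest_cycle V E c \<Longrightarrow> S \<inter> set c \<noteq> {}"
proof (rule ccontr)
  define k where "k = clique_number V E"
  assume "\<not> thesis"
  with that have avoid: "\<exists>c. is_longest_cycle V E c \<and> S \<inter> set c = {}"
    if "S \<subseteq> V" "card S \<le> max 1 (k - 3)" for S
    using that unfolding k_def by blast
  obtain c0 where c0: "is_longest_cycle V E c0" using avoid[of "{}"] by auto
  define L where "L = length c0"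
  have longest: "is_cycle E c" "length c = L" if "is_longest_cycle V E c" for c
    using that c0 unfolding L_def is_longest_cycle_def by (auto intro: order_antisym)
  have L: "length c \<le> L" if "is_cycle E c" for c
    using that c0 cycle_V[OF that] unfolding L_def is_longest_cycle_def by auto
  have L3: "L \<ge> 3" using longest[OF c0] by (auto simp: is_cycle_def)
  have fin: "finite X" if "X \<subseteq> V" for X using that finV finite_subset by blast

  \<comment> \<open>The cycle avoids \<open>x\<close> and as many further vertices of
    \<open>X\<close> as the bound permits; since \<open>card X\<close> is at most
    \<open>k - 1\<close>, at most two vertices of \<open>X\<close> remain for it.\<close>
  have avoid2: "\<exists>c. is_longest_cycle V E c \<and> x \<notin> set c \<and> card (set c \<inter> X) \<le> 2"
    if X: "X \<subseteq> V" "card X < k" "x \<in> X" for X x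
  proof -
    have "card (X - {x}) = card X - 1" using X(3) by simp
    moreover have "card X \<ge> 1" using X fin[OF X(1)] card_gt_0_iff[of X] by fastforce
    ultimately obtain T where T: "T \<subseteq> X - {x}" "card T = min (max 1 (k - 3)) (card X) - 1"
      using obtain_subset_with_card_n[of "min (max 1 (k - 3)) (card X) - 1" "X - {x}"]
      by (metis diff_le_mono min.cobounded2)
    let ?S = "insert x T"
    have S: "?S \<subseteq> X" using T X by auto
    have "finite T" "x \<notin> T" using T fin[OF X(1)] finite_subset by blast+
    then have cS: "card ?S = min (max 1 (k - 3)) (card X)" using T(2) \<open>card X \<ge> 1\<close> by simp
    then obtain c where c: "is_longest_cycle V E c" "?S \<inter> set c = {}"
      using avoid[of ?S] S X by auto
    have "set c \<inter> X \<subseteq> X - ?S" using c(2) by auto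
    then have "card (set c \<inter> X) \<le> card (X - ?S)" using fin[OF X(1)] by (simp add: card_mono)
    also have "\<dots> = card X - card ?S" using S \<open>finite T\<close> by (intro card_Diff_subset) auto
    also have "\<dots> \<le> 2" using cS X(2) by auto
    finally show ?thesis using c by auto
  qed

  define heavy where "heavy B \<longleftrightarrow> connected_on B E \<and> B \<subseteq> V \<and> is_clique V E (nbhd E B) \<and>
    (\<exists>a q b. ear E (nbhd E B) a q b \<and> set q \<subseteq> B \<and> L \<le> 2 * (length q + 1))" for B
  have heavyI: "\<exists>B. heavy B \<and> B \<inter> X = {} \<and> nbhd E B \<subseteq> X \<and> set q \<subseteq> B"
    if e: "ear E X a q b" "L \<le> 2 * (length q + 1)" and X: "is_clique V E X" for X a q b
  proof -
    \<comment> \<open>As \<open>L\<close> is at least 3, a long ear is not a single edge, so its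
      interior determines a component.\<close>
    have "q \<noteq> []" using e(2) L3 by auto
    then obtain B where B: "connected_on B E" "B \<subseteq> V" "B \<inter> X = {}" "nbhd E B \<subseteq> X"
      "set q \<subseteq> B" "a \<in> nbhd E B" "b \<in> nbhd E B" using ear_component[OF e(1)] by metis
    then have "ear E (nbhd E B) a q b" using e(1) B(4) by (auto simp: ear_def)
    then have "heavy B" using B e(2) is_clique_subset[OF X B(4)] unfolding heavy_def by blast
    then show ?thesis using B by blast
  qed

  \<comment> \<open>The two ends of an edge serve as the clique: no cycle meets it in more than two
    vertices.\<close>
  have "\<exists>B. heavy B"
  proof -
    obtain a where a: "a \<in> set c0" using L3 by (cases c0) (auto simp: L_def)
    then obtain r where "is_cycle E (a # r)" using is_cycle_from longest(1)[OF c0] by metis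
    then obtain b where ab: "E a b"
      by (cases r) (auto simp: is_cycle_iff_successively)
    then have "a \<noteq> b" using not_adj_self by auto
    have cl: "is_clique V E {a, b}" using ab adj_sym adj_V by (auto simp: is_clique_def)
    obtain c where c: "is_longest_cycle V E c" "{a} \<inter> set c = {}"
      using avoid[of "{a}"] ab adj_V by auto
    have "card (set c \<inter> {a, b}) \<le> card {a, b}" by (rule card_mono) auto
    then have "card (set c \<inter> {a, b}) \<le> 2" using \<open>a \<noteq> b\<close> by simp
    then obtain u q v where "ear E {a, b} u q v" "length c \<le> 2 * (length q + 1)"
      using long_ear_exists[OF cl _ longest(1)[OF c(1)]] \<open>a \<noteq> b\<close> by (metis card_2_iff order_refl)
    then show ?thesis using heavyI cl longest(2)[OF c(1)] by blast
  qed
  then obtain B where heavyB: "heavy B" and minB: "\<And>B'. heavy B' \<Longrightarrow> card B \<le> card B'"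
    using ex_has_least_nat[of heavy _ card] by blast
  define X where "X = nbhd E B"
  obtain a q b where B: "connected_on B E" "B \<subseteq> V" and clX: "is_clique V E X"
    and e: "ear E X a q b" "set q \<subseteq> B" "L \<le> 2 * (length q + 1)"
    using heavyB unfolding heavy_def X_def by blast
  have XV: "X \<subseteq> V" unfolding X_def by (rule nbhd_V)
  have ab: "a \<in> X" "b \<in> X" "a \<noteq> b" using e(1) by (auto simp: ear_def)
  then have X2: "card X \<ge> 2" using fin[OF XV] card_mono[of X "{a, b}"] by auto
  have "B \<noteq> {}" using ab by (auto simp: X_def nbhd_def)
  then obtain v where v: "v \<in> B" "\<And>x. x \<in> X \<Longrightarrow> E v x"
    using dominating_vertex[OF B] clX unfolding X_def by blast
  have vX: "v \<notin> X" using v by (auto simp: X_def nbhd_def)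
  define Y where "Y = insert v X"
  have clY: "is_clique V E Y" using clX v adj_sym B(2) by (auto simp: is_clique_def Y_def)
  then have YV: "Y \<subseteq> V" by (simp add: is_clique_def)
  have cardY: "card Y = Suc (card X)" unfolding Y_def using fin[OF XV] vX by simp
  have Yk: "card Y \<le> k" using card_clique_le[OF clY] by (simp add: k_def)

  \<comment> \<open>The joined cycle has at least \<open>length q1 + length q2 + 2\<close> vertices,
    which is already at least \<open>L\<close>; maximality of \<open>L\<close> leaves only equality
    throughout.\<close>
  have tight: "{a1, b1} = {a2, b2} \<and> 2 * (length q1 + 1) = L \<and> 2 * (length q2 + 1) = L"
    if asm: "ear E X a1 q1 b1" "L \<le> 2 * (length q1 + 1)" "ear E X a2 q2 b2" "L \<le> 2 * (length q2 + 1)"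
      "set q1 \<inter> set q2 = {}" for a1 q1 b1 a2 q2 b2
  proof -
    have "length q1 + length q2 \<ge> 1" using asm L3 by auto
    then obtain s where s: "is_cycle E s" "length s \<ge> length q1 + length q2 + 2"
      "{a1, b1} \<noteq> {a2, b2} \<Longrightarrow> length s > length q1 + length q2 + 2"
      using join_ears[OF clX asm(1,3,5)] by metis
    then show ?thesis using L[OF s(1)] asm(2,4) by fastforce
  qed

  have no_outer: False
    if e': "ear E X a' q' b'" "L \<le> 2 * (length q' + 1)" "set q' \<inter> B = {}" for a' q' b'
  proof -
    have t: "{a, b} = {a', b'}" "2 * (length q + 1) = L" "2 * (length q' + 1) = L"
      using tight[OF e(1,3) e'(1,2)] e(2) e'(3) by auto
    have "card X < k" using cardY Yk by simp
    then obtain c where c: "is_longest_cycle V E c" "a \<notin> set c" "card (set c \<inter> X) \<le> 2"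
      using avoid2[OF XV] ab by blast
    obtain a2 q2 b2 where e2: "ear E X a2 q2 b2" "L \<le> 2 * (length q2 + 1)"
      "set c \<inter> X = {a2, b2} \<or> L < 2 * (length q2 + 1)"
      using long_ear_exists[OF clX X2 longest(1)[OF c(1)] c(3)] longest(2)[OF c(1)] by metis
    \<comment> \<open>In the case of equality the trace of \<open>c\<close> on \<open>X\<close>
      would be \<open>{a, b}\<close>, but \<open>c\<close> misses \<open>a\<close>.\<close>
    have ne: "\<not> ({a, b} = {a2, b2} \<and> 2 * (length q2 + 1) = L)"
      using e2(3) c(2) by auto
    obtain B2 where B2: "heavy B2" "B2 \<inter> X = {}" "set q2 \<subseteq> B2" using heavyI[OF e2(1,2) clX] by blast
    \<comment> \<open>The third long ear lies outside \<open>B\<close> or inside it, hence is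
      disjoint from the ear in \<open>B\<close> or from the outer one; either way
      \<open>tight\<close> contradicts \<open>ne\<close>.\<close>
    show False
    proof (cases "B2 \<inter> B = {}")
      case True
      then show False using tight[OF e(1,3) e2(1,2)] e(2) B2(3) ne by blast
    next
      case False
      then obtain u where "u \<in> B2" "u \<in> B" by auto
      then have "B2 \<subseteq> B"
        using connected_on_subset_if_nbhd_disjoint[of B2 E B u] B2 unfolding heavy_def X_def by blast
      then have "set q' \<inter> set q2 = {}" using B2(3) e'(3) by blast
      then show False using tight[OF e'(1,2) e2(1,2)] ne t(1) by auto
    qed
  qed

  have meet3: "card (set c \<inter> Y) \<ge> 3" if c: "is_longest_cycle V E c" for c
  proof (rule ccontr)
    assume "\<not> card (set c \<inter> Y) \<ge> 3"
    then have "card (set c \<inter> Y) \<le> 2" by simp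
    then obtain a1 q1 b1 where e1: "ear E Y a1 q1 b1" "L \<le> 2 * (length q1 + 1)"
      using long_ear_exists[OF clY _ longest(1)[OF c]] longest(2)[OF c] cardY X2 
      by (metis Suc_leD Suc_le_mono)
    obtain B1 where B1: "heavy B1" "B1 \<inter> Y = {}" "nbhd E B1 \<subseteq> Y" "set q1 \<subseteq> B1"
      using heavyI[OF e1 clY] by blast
    show False
    proof (cases "B1 \<inter> B = {}")
      case False
      then obtain u where "u \<in> B1" "u \<in> B" by auto
      then have "B1 \<subseteq> B"
        using connected_on_subset_if_nbhd_disjoint[of B1 E B u] B1
        unfolding heavy_def X_def Y_def by blast
      then have "B1 \<subset> B" using v(1) B1(2) by (auto simp: Y_def)
      then have "card B1 < card B" using fin[OF B(2)] by (simp add: psubset_card_mono)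
      then show False using minB[OF B1(1)] by simp
    next
      case True
      \<comment> \<open>\<open>B1\<close> avoids both \<open>B\<close> and its neighbourhood, so
        \<open>v\<close> is no end of the ear, which is therefore an ear of \<open>X\<close> outside
        \<open>B\<close>.\<close>
      have "\<not> E v u" if "u \<in> B1" for u
        using nbhdI[of E v u B] v(1) that True B1(2) unfolding Y_def X_def by blast
      moreover have "q1 \<noteq> []" using e1(2) L3 by auto
      then have "hd q1 \<in> B1" "last q1 \<in> B1" "E a1 (hd q1)" "E (last q1) b1"
        using B1(4) e1(1) by (auto simp: ear_def successively_append_iff successively_Cons)
      ultimately have "a1 \<noteq> v" "b1 \<noteq> v" using adj_sym by blast+
      then have "ear E X a1 q1 b1" using e1(1) by (auto simp: ear_def Y_def)
      then show False using no_outer e1(2) B1(4) True by blast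
    qed
  qed

  have cY: "card Y = k"
  proof (rule ccontr)
    assume "card Y \<noteq> k"
    then have "card Y < k" using Yk by simp
    then show False using avoid2[OF YV, of v] meet3 by (fastforce simp: Y_def)
  qed
  have Y4: "card Y \<ge> 4"
  proof -
    obtain c where c: "is_longest_cycle V E c" "{v} \<inter> set c = {}"
      using avoid[of "{v}"] v(1) B(2) by auto
    then have "set c \<inter> Y \<subseteq> X" by (auto simp: Y_def)
    then have "card (set c \<inter> Y) \<le> card X" by (rule card_mono[OF fin[OF XV]])
    then show ?thesis using meet3[OF c(1)] cardY by simp
  qed
  \<comment> \<open>\<open>Y\<close> has \<open>k - 3\<close> vertices outside \<open>T\<close>, so
    some longest cycle avoids them all, and \<open>meet3\<close> forces it through all of
    \<open>T\<close>.\<close>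
  have triple: "\<exists>c. is_longest_cycle V E c \<and> set c \<inter> Y = T" if T: "T \<subseteq> Y" "card T = 3" for T
  proof -
    have finT: "finite T" using T fin[OF YV] finite_subset by blast
    have "card (Y - T) = k - 3" using T cY card_Diff_subset[OF finT T(1)] by simp
    then obtain c where c: "is_longest_cycle V E c" "(Y - T) \<inter> set c = {}"
      using avoid[of "Y - T"] YV by auto
    then have "set c \<inter> Y \<subseteq> T" by auto
    moreover have "card T \<le> card (set c \<inter> Y)" using meet3[OF c(1)] T(2) by simp
    ultimately have "set c \<inter> Y = T" using finT card_seteq by blast
    then show ?thesis using c by blast
  qed

  \<comment> \<open>A greatest \<open>n\<close> exists: inner vertices are distinct, which bounds
    their number by \<open>card V\<close>, and the edge between \<open>a\<close> and
    \<open>b\<close> gives 0.\<close>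
  define isear where "isear n \<longleftrightarrow> (\<exists>a q b. ear E Y a q b \<and> length q = n)" for n
  have "n \<le> card V" if n: "isear n" for n
  proof -
    obtain a q b where q: "ear E Y a q b" "length q = n" using n unfolding isear_def by blast
    then have "card (set q) = n" by (simp add: ear_def distinct_card)
    then show ?thesis using card_mono[OF finV ear_V[OF q(1)]] by simp
  qed
  moreover have "isear 0"
    unfolding isear_def using ab clY by (intro exI[of _ a] exI[of _ "[]"] exI[of _ b])
      (auto simp: ear_def Y_def is_clique_def)
  ultimately obtain n where n: "isear n" "\<And>m. isear m \<Longrightarrow> m \<le> n"
    using Nat.ex_has_greatest_nat[of isear 0 "card V"] by blast
  then obtain x p y where p: "ear E Y x p y" "length p = n" unfolding isear_def by blast
  have xy: "x \<in> Y" "y \<in> Y" "x \<noteq> y" using p by (auto simp: ear_def)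
  \<comment> \<open>If the longest ear is a single edge, there is no interior to locate and
    \<open>D = {}\<close> serves as the default.\<close>
  obtain D where D: "connected_on D E" "D \<subseteq> V" "D \<inter> Y = {}" "nbhd E D \<subseteq> Y" "set p \<subseteq> D"
    "D = {} \<or> x \<in> nbhd E D \<and> y \<in> nbhd E D"
  proof (cases "p = []")
    case True
    then show thesis by (intro that[of "{}"]) (auto simp: connected_on_def nbhd_def)
  next
    case False
    then show thesis using ear_component[OF p(1)] that by metis
  qed
  \<comment> \<open>A vertex of \<open>D\<close> adjacent to all of \<open>Y\<close> would enlarge
    the maximum clique.\<close>
  have "\<not> Y \<subseteq> nbhd E D"
  proof
    assume Y: "Y \<subseteq> nbhd E D"
    then have "D \<noteq> {}" using xy by (auto simp: nbhd_def)
    then obtain u where u: "u \<in> D" "\<And>z. z \<in> Y \<Longrightarrow> E u z"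
      using dominating_vertex[OF D(1,2) _ Y clY] by blast
    then have "is_clique V E (insert u Y)" using clY adj_sym D(2) by (auto simp: is_clique_def)
    from card_clique_le[OF this] show False
      using u D(3) fin[OF YV] cY k_def by (simp add: disjoint_iff)
  qed
  \<comment> \<open>For nonempty \<open>D\<close>, the ends \<open>x\<close> and \<open>y\<close>
    are neighbours of \<open>D\<close>, so \<open>w\<close> differs from them automatically; for
    empty \<open>D\<close>, any third vertex of \<open>Y\<close> will do.\<close>
  have "\<exists>w\<in>Y. w \<noteq> x \<and> w \<noteq> y \<and> w \<notin> nbhd E D"
  proof (cases "D = {}")
    case True
    have "\<not> Y \<subseteq> {x, y}" using Y4 card_mono[of "{x, y}" Y] xy(3) by auto
    then show ?thesis using True by (auto simp: nbhd_def)
  next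
    case False
    then have nb: "x \<in> nbhd E D" "y \<in> nbhd E D" using D(6) by auto
    obtain w where "w \<in> Y" "w \<notin> nbhd E D" using \<open>\<not> Y \<subseteq> nbhd E D\<close> by auto
    with nb show ?thesis by (intro bexI[of _ w]) auto
  qed
  then obtain w where w: "w \<in> Y" "w \<noteq> x" "w \<noteq> y" "w \<notin> nbhd E D" by blast
  obtain z where z: "z \<in> Y" "z \<noteq> x" "z \<noteq> y" "z \<noteq> w"
  proof -
    have "\<not> Y \<subseteq> {x, y, w}"
    proof
      assume "Y \<subseteq> {x, y, w}"
      then have "card Y \<le> card {x, y, w}" by (intro card_mono) auto
      then show False using Y4 xy(3) w(2,3) by simp
    qed
    then show thesis using that by blast
  qed
  obtain c where c: "is_longest_cycle V E c" "set c \<inter> Y = {x, z, w}"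
    using triple[of "{x, z, w}"] xy z w by auto
  obtain r1 r2 r3 where r: "ear E Y x r1 z" "ear E Y z r2 w" "ear E Y w r3 x"
    "length r1 + length r2 + length r3 + 3 = length c" "set r2 \<inter> set r3 = {}"
    using cycle_split3[OF longest(1)[OF c(1)] adj_sym c(2)] z w by metis
  \<comment> \<open>An ear starting at \<open>w\<close> that entered \<open>D\<close> would have its
    whole interior there, making \<open>w\<close> a neighbour of \<open>D\<close>.\<close>
  have avoidD: "set s \<inter> D = {}" if s: "ear E Y w s t" for s t
  proof (rule ccontr)
    assume "set s \<inter> D \<noteq> {}"
    then obtain u where u: "u \<in> set s" "u \<in> D" by auto
    then have "s \<noteq> []" by auto
    then obtain D' where D': "connected_on D' E" "D' \<inter> Y = {}" "set s \<subseteq> D'" "w \<in> nbhd E D'"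
      using ear_component[OF s] by metis
    have "D' \<subseteq> D"
      using connected_on_subset_if_nbhd_disjoint[of D' E D u] D' u D(4) by blast
    then have "w \<in> nbhd E D" using D'(4) w(1) D(3) by (auto simp: nbhd_def)
    then show False using w(4) by simp
  qed
  have d: "set r2 \<inter> D = {}" "set r3 \<inter> D = {}"
    using avoidD[OF ear_rev[OF r(2)]] avoidD[OF r(3)] by auto
  \<comment> \<open>The segment \<open>r1\<close> is replaced by \<open>p\<close> and the edge from
    \<open>y\<close> to \<open>z\<close>. The segments \<open>r2\<close> and \<open>r3\<close> end
    in \<open>w\<close>, so they avoid \<open>D\<close> and with it \<open>p\<close>.\<close>
  let ?c = "x # p @ y # z # r2 @ w # r3"
  have "E y z" using clY z xy by (auto simp: is_clique_def)
  have "is_cycle E ?c"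
  proof -
    have "successively E ((z # r2) @ [w])" "successively E (w # (r3 @ [x]))"
      "successively E ((x # p) @ [y])"
      using p(1) r(2,3) by (auto simp: ear_def)
    from successively_join[OF this(1,2)] successively_join[OF this(3), of "z # r2 @ w # r3 @ [x]"]
    have "successively E (?c @ [x])" using \<open>E y z\<close> by simp
    moreover have "distinct ?c"
      using p(1) r(2,3,5) d D(5) z w xy by (auto simp: ear_def)
    ultimately show ?thesis by (simp add: is_cycle_iff_successively)
  qed
  \<comment> \<open>The new cycle has \<open>n + length r2 + length r3 + 4\<close> vertices against
    \<open>length r1 + length r2 + length r3 + 3\<close> on \<open>c\<close>; the extra vertex
    \<open>y\<close> makes the inequality strict.\<close>
  from L[OF this] have "length r1 > n" using r(4) longest(2)[OF c(1)] p(2) by simp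
  moreover have "isear (length r1)" using r(1) unfolding isear_def by blast
  ultimately show False using n(2) by fastforce
qed

end

theorem theorem7p2:
  fixes V :: "'a set" and E :: "'a \<Rightarrow> 'a \<Rightarrow> bool"
  assumes "simple_graph V E" and "two_connected V E" and "chordal V E"
  shows "lct V E \<le> max 1 (clique_number V E - 3)"
proof -
  interpret two_connected_chordal_graph V E
    using assms by unfold_locales
  obtain S where S: "S \<subseteq> V" "card S \<le> max 1 (clique_number V E - 3)"
    "\<And>c. is_longest_cycle V E c \<Longrightarrow> S \<inter> set c \<noteq> {}"
    using small_longest_cycle_transversal by blast
  have "lct V E \<le> card S"
    unfolding lct_def by (rule Least_le) (use S in blast)
  with S(2) show ?thesis by simp
qed

end
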